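(* Suppose that $k\ge 2$ is an integer and $F$ is a finite field. Then every element $a\in F$ can be decomposed into a product $a=a_1a_2\cdots a_k$ of $k$ factors $a_i\in F$ whose sum $a_1+\dots+a_k$ vanishes if and only if one of the following holds: (1) $|F|=2$ and $k$ is even; (2) $|F|=4$ and $k\ne 3$; (3) $|F|$ is a power of two but neither two nor four (and $k$ is arbitrary); (4) $|F|\in\{3,5\}$ and $k\notin\{2,4\}$; (5) $|F|=7$ and $k\notin\{2,3\}$; (6) $|F|$ is neither a power of two nor three nor five nor seven, and $k\ne 2$.
   Context: The factors are arbitrary elements of the field (repetitions, and factors equal to $0$, $1$ or $-1$, are allowed). *)

theory Defs
  imports "HOL-Library.Cardinality"
begin

end

theory Submission
  imports Defs "HOL-Number_Theory.Cong" "HOL-Computational_Algebra.Polynomial"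
begin

text \<open>
  Call \<open>a\<close> balanced for \<open>k\<close> if it is a product of \<open>k\<close> factors with sum zero. If all elements
  are balanced for \<open>k\<close>, then they are balanced for \<open>k + 2\<close>, by adjoining the factors \<open>1\<close> and
  \<open>-1\<close>. Hence for each parity of \<open>k\<close> only the smallest good \<open>k\<close> has to be found, and the
  theorem comes down to \<open>k = 2, 3, 4\<close> and a few exceptional fields.

  For \<open>k = 2\<close> the balanced elements are those of the form \<open>- (x ^ 2)\<close>. These are all
  elements exactly in characteristic two, that is, if the number of elements is a power of
  two (\<open>all_balanced_2_iff\<close>, \<open>card_eq_power_of_2_iff\<close>).

  For \<open>k = 3\<close> one has to find points on the cubic curves \<open>x * y * (x + y) = - a\<close>. If every
  element is a cube, scaling one decomposition is enough. Otherwise there is a primitive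
  cube root of unity, and a linear change of variables turns the question into whether \<open>a\<close>
  is a sum of two cubes. That this is so except for 4 and 7 elements is
  \<open>noncube_is_sum_of_two_cubes\<close>. It replaces the Hasse bound by an elementary double count:
  the counts of solutions of \<open>u * s + v * t = w\<close> in cubes satisfy a quadratic relation
  which, if one of them vanishes, only leaves the two small fields.

  For \<open>k = 4\<close> in odd characteristic, two factors with sum 2 and two with sum \<open>- 2\<close> give the
  products \<open>(1 - u ^ 2) * (1 - v ^ 2)\<close>. If \<open>a\<close> is not balanced, then neither is \<open>s ^ 4 * a\<close>,
  so neither of them has this form; comparing the two failures yields a contradiction as
  soon as not all nonzero fourth powers are 1, which excludes only 3 and 5 elements
  (\<open>balanced_4\<close>).

  In the fields with 2, 3, 4, 5 and 7 elements the powers that occur have very few values,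
  and the remaining decompositions and obstructions can be written down explicitly.
\<close>

section \<open>Products of elements with vanishing sum\<close>

text \<open>
  Lists instead of functions on \<open>{1..k}\<close>: concrete decompositions can then be written down
  and prolonged.
\<close>
definition balanced :: "nat \<Rightarrow> 'a :: comm_ring_1 \<Rightarrow> bool" where
  "balanced k a \<longleftrightarrow> (\<exists>xs. length xs = k \<and> prod_list xs = a \<and> sum_list xs = 0)"

lemma balancedI: "length xs = k \<Longrightarrow> prod_list xs = a \<Longrightarrow> sum_list xs = 0 \<Longrightarrow> balanced k a"
  unfolding balanced_def by blast

lemma balanced_iff_indexed:
  "balanced k a \<longleftrightarrow> (\<exists>x :: nat \<Rightarrow> 'a :: comm_ring_1.
     a = (\<Prod>i = 1..k. x i) \<and> (\<Sum>i = 1..k. x i) = 0)"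
proof -
  have lists: "(\<exists>xs. length xs = k \<and> P xs) \<longleftrightarrow> (\<exists>x. P (map x [1..<Suc k]))"
    for P :: "'a list \<Rightarrow> bool"
  proof
    assume "\<exists>xs. length xs = k \<and> P xs"
    then obtain xs where xs: "length xs = k" "P xs" by blast
    have "map (\<lambda>i. xs ! (i - 1)) [1..<Suc k] = xs"
      using xs(1) by (intro nth_equalityI) (auto simp del: upt_Suc)
    with xs(2) show "\<exists>x. P (map x [1..<Suc k])" by metis
  next
    assume "\<exists>x. P (map x [1..<Suc k])"
    then obtain x where "P (map x [1..<Suc k])" by blast
    then show "\<exists>xs. length xs = k \<and> P xs"
      by (intro exI[of _ "map x [1..<Suc k]"]) (auto simp del: upt_Suc)
  qed
  have "prod_list (map x [1..<Suc k]) = (\<Prod>i = 1..k. x i)"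
    and "sum_list (map x [1..<Suc k]) = (\<Sum>i = 1..k. x i)" for x :: "nat \<Rightarrow> 'a"
    by (simp_all add: prod.distinct_set_conv_list[symmetric] sum.distinct_set_conv_list[symmetric]
        atLeastLessThanSuc_atLeastAtMost del: upt_Suc)
  then show ?thesis
    unfolding balanced_def using lists[of "\<lambda>xs. prod_list xs = a \<and> sum_list xs = 0"]
    by (auto simp del: upt_Suc)
qed

lemma balanced_0: "k \<ge> 1 \<Longrightarrow> balanced k 0"
  by (rule balancedI[of "replicate k 0"]) (auto simp: prod_list_replicate sum_list_replicate power_0_left)

text \<open>
  Scaling all factors by \<open>c\<close> keeps the sum zero. In a field, whether \<open>a\<close> is balanced
  therefore only depends on the class of \<open>a\<close> modulo nonzero \<open>k\<close>-th powers.
\<close>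
lemma balanced_scale:
  fixes c :: "'a :: comm_ring_1"
  assumes "balanced k a"
  shows "balanced k (c ^ k * a)"
proof -
  obtain xs where xs: "length xs = k" "prod_list xs = a" "sum_list xs = 0"
    using assms unfolding balanced_def by blast
  have "prod_list (map ((*) c) ys) = c ^ length ys * prod_list ys" for ys
    by (induction ys) (auto simp: algebra_simps)
  then show ?thesis
    using xs by (intro balancedI[of "map ((*) c) xs"]) (auto simp: sum_list_const_mult)
qed

text \<open>
  The pair \<open>1, -1\<close> has sum zero and product \<open>-1\<close>; since every element is assumed balanced,
  the sign can be absorbed by starting from \<open>- a\<close>.
\<close>
lemma balanced_add_2:
  fixes a :: "'a :: comm_ring_1"
  assumes "\<forall>a :: 'a. balanced k a"
  shows "balanced (k + 2) a"
proof -
  obtain xs where xs: "length xs = k" "prod_list xs = - a" "sum_list xs = 0"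
    using assms unfolding balanced_def by blast
  then show ?thesis
    by (intro balancedI[of "1 # -1 # xs"]) auto
qed

lemma balanced_add_even:
  fixes a :: "'a :: comm_ring_1"
  assumes "\<forall>a :: 'a. balanced k a" and "k \<le> l" and "even (l - k)"
  shows "balanced l a"
proof -
  obtain m where m: "l = k + 2 * m"
    using assms by (metis dvdE le_add_diff_inverse)
  have "\<forall>a :: 'a. balanced (k + 2 * m) a"
  proof (induction m)
    case (Suc m)
    have "balanced (k + 2 * m + 2) a" for a :: 'a
      by (rule balanced_add_2) (rule Suc)
    then show ?case by simp
  qed (use assms in simp)
  then show ?thesis using m by simp
qed

section \<open>Counting in finite fields\<close>

lemma power_card_minus_1:
  fixes x :: "'a :: {field, finite}"
  assumes "x \<noteq> 0"
  shows "x ^ (CARD('a) - 1) = 1"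
proof -
  have "(\<Prod>y\<in>UNIV - {0}. x * y) = (\<Prod>y\<in>UNIV - {0}. y)"
    by (rule prod.reindex_bij_witness[of _ "\<lambda>y. y / x" "\<lambda>y. x * y"]) (use assms in auto)
  then show ?thesis
    by (simp add: prod.distrib)
qed

text \<open>
  The translation \<open>x \<mapsto> x + 1\<close> permutes the field, so it does not change the sum of
  all elements.
\<close>
lemma of_nat_card_eq_0: "of_nat CARD('a) = (0 :: 'a :: {field, finite})"
proof -
  have "(\<Sum>x\<in>UNIV. x + 1) = (\<Sum>x\<in>UNIV. x :: 'a)"
    by (rule sum.reindex_bij_witness[of _ "\<lambda>x. x - 1" "\<lambda>x. x + 1"]) auto
  then show ?thesis
    by (simp add: sum.distrib)
qed

lemma card_field_gt_1: "CARD('a :: {zero_neq_one, finite}) > 1"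
  using card_mono[of "UNIV :: 'a set" "{0, 1}"] by simp

lemma exists_avoiding_two:
  assumes "CARD('a :: {zero_neq_one, finite}) \<noteq> 2"
  shows "\<exists>x :: 'a. x \<noteq> b \<and> x \<noteq> c"
proof (rule ccontr)
  assume "\<not> ?thesis"
  then have "UNIV = {b, c}" by blast
  then have "CARD('a) = card {b, c}" by (rule arg_cong)
  moreover have "card {b, c} \<le> 2" by (cases "b = c") auto
  ultimately show False using assms card_field_gt_1[where 'a = 'a] by linarith
qed

lemma card_nonzero: "card (- {0 :: 'a :: {zero, finite}}) = CARD('a) - 1"
  by (simp add: Compl_eq_Diff_UNIV card_Diff_singleton)

text \<open>
  Every fibre of \<open>x \<mapsto> x ^ n\<close> on the nonzero elements is a multiple of the set of
  \<open>n\<close>-th roots of unity. This counts squares and cubes without knowing that the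
  multiplicative group is cyclic.
\<close>
lemma card_powers_mult_card_roots_of_unity:
  assumes "n > 0"
  shows "card ((\<lambda>x :: 'a :: {field, finite}. x ^ n) ` (- {0})) * card {x :: 'a. x ^ n = 1} = CARD('a) - 1"
proof -
  have fibre: "card {x \<in> - {0}. x ^ n = y} = card {x :: 'a. x ^ n = 1}"
    if y: "y \<in> (\<lambda>x. x ^ n) ` (- {0})" for y :: 'a
  proof -
    obtain z where z: "z \<noteq> 0" "y = z ^ n" using y by auto
    have "bij_betw (\<lambda>x. z * x) {x. x ^ n = 1} {x \<in> - {0}. x ^ n = y}"
      by (rule bij_betw_byWitness[where f' = "\<lambda>x. x / z"])
        (use z assms in \<open>auto simp: power_mult_distrib power_divide power_0_left\<close>)
    then show ?thesis by (simp add: bij_betw_same_card)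
  qed
  have "CARD('a) - 1 = (\<Sum>x\<in>- {0 :: 'a}. 1)"
    by (simp add: card_nonzero)
  also have "\<dots> = (\<Sum>y\<in>(\<lambda>x. x ^ n) ` (- {0}). \<Sum>x\<in>{x \<in> - {0 :: 'a}. x ^ n = y}. 1)"
    by (rule sum.image_gen) simp
  also have "\<dots> = (\<Sum>y\<in>(\<lambda>x. x ^ n) ` (- {0 :: 'a}). card {x :: 'a. x ^ n = 1})"
    by (rule sum.cong) (use fibre in auto)
  finally show ?thesis by simp
qed

text \<open>
  If \<open>2 = 0\<close>, then an additively closed set \<open>H\<close> containing 0 and missing some \<open>x\<close> is
  disjoint from its translate by \<open>x\<close>, and the union of the two is again additively closed,
  with twice as many elements. A maximal such set whose size is a power of two is therefore
  the whole field.
\<close>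
lemma card_eq_power_of_2_iff:
  "(\<exists>n. CARD('a :: {field, finite}) = 2 ^ n) \<longleftrightarrow> (2 :: 'a) = 0"
proof
  assume "\<exists>n. CARD('a) = 2 ^ n"
  then obtain n where "CARD('a) = 2 ^ n" by blast
  then have "(2 :: 'a) ^ n = 0"
    using of_nat_card_eq_0[where 'a = 'a] by simp
  then show "(2 :: 'a) = 0" by simp
next
  assume two: "(2 :: 'a) = 0"
  have double: "x + x = 0" for x :: 'a
    using two by (metis mult_2 mult_zero_left)
  define P where "P H \<longleftrightarrow> 0 \<in> H \<and> (\<forall>x\<in>H. \<forall>y\<in>H. x + y \<in> H) \<and> (\<exists>n. card H = 2 ^ n)"
    for H :: "'a set"
  have "P {0}" by (auto simp: P_def intro: exI[of _ 0])
  moreover have "finite (Collect P)" by simp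
  ultimately obtain H where H: "P H" and max: "\<And>H'. P H' \<Longrightarrow> H \<subseteq> H' \<Longrightarrow> H' = H"
    using finite_has_maximal[of "Collect P"] by (metis empty_iff mem_Collect_eq)
  have "H = UNIV"
  proof (rule ccontr)
    assume "H \<noteq> UNIV"
    then obtain x where x: "x \<notin> H" by blast
    define H' where "H' = H \<union> (+) x ` H"
    obtain n where n: "card H = 2 ^ n" using H by (auto simp: P_def)
    have add: "y + z \<in> H" if "y \<in> H" "z \<in> H" for y z using H that by (auto simp: P_def)
    have disj: "H \<inter> (+) x ` H = {}"
    proof (rule ccontr)
      assume "H \<inter> (+) x ` H \<noteq> {}"
      then obtain y where "y \<in> H" "x + y \<in> H" by auto
      then have "(x + y) + y \<in> H" using add by blast
      then show False using x double[of y] by (simp add: add.assoc)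
    qed
    have "card H' = 2 ^ Suc n"
      unfolding H'_def using disj n by (simp add: card_Un_disjoint card_image)
    moreover have "0 \<in> H'" using H by (auto simp: H'_def P_def)
    moreover have "y + z \<in> H'" if yz: "y \<in> H'" "z \<in> H'" for y z
    proof -
      have both: "(x + y) + (x + z) \<in> H" if "y \<in> H" "z \<in> H" for y z
      proof -
        have "(x + y) + (x + z) = (x + x) + (y + z)" by (simp only: add_ac)
        then show ?thesis using add[OF that] by (simp only: double add_0)
      qed
      have one: "x + y + z \<in> (+) x ` H" "y + (x + z) \<in> (+) x ` H" if "y \<in> H" "z \<in> H" for y z
        using add[OF that] by (auto simp: algebra_simps intro!: image_eqI[of _ _ "y + z"])
      have "y \<in> H \<or> (\<exists>y'\<in>H. y = x + y')" "z \<in> H \<or> (\<exists>z'\<in>H. z = x + z')"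
        using yz by (auto simp: H'_def)
      then show ?thesis
        unfolding H'_def Un_iff by (elim disjE bexE) (simp_all only: both one add simp_thms)
    qed
    ultimately have "P H'" unfolding P_def by blast
    then have "H' = H" by (rule max) (auto simp: H'_def)
    then show False using x H by (auto simp: H'_def P_def)
  qed
  then show "\<exists>n. CARD('a) = 2 ^ n" using H by (auto simp: P_def)
qed

text \<open>
  A field of prime order consists of the residues modulo that prime, which reduces the
  negative statements about 3, 5 and 7 elements to finite checks on natural numbers.
\<close>
lemma prime_field_elements:
  assumes p: "prime CARD('a :: {field, finite})"
  shows "CHAR('a) = CARD('a)" and "\<exists>m < CARD('a). x = (of_nat m :: 'a)"
proof -
  have "CHAR('a) dvd CARD('a)"
    using of_nat_card_eq_0[where 'a = 'a] by (simp add: of_nat_eq_0_iff_char_dvd)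
  then show char: "CHAR('a) = CARD('a)"
    using p by (metis CHAR_not_1' One_nat_def prime_nat_iff)
  have "inj_on (of_nat :: nat \<Rightarrow> 'a) {..<CARD('a)}"
    by (rule inj_onI) (simp add: of_nat_eq_iff_cong_CHAR char cong_def)
  then have "card (of_nat ` {..<CARD('a)} :: 'a set) = CARD('a)"
    by (simp add: card_image)
  then have "(of_nat ` {..<CARD('a)} :: 'a set) = UNIV"
    by (simp add: card_eq_UNIV_imp_eq_UNIV)
  then show "\<exists>m < CARD('a). x = (of_nat m :: 'a)" by auto
qed

section \<open>Four factors in odd characteristic\<close>

definition sq :: "'a :: field \<Rightarrow> bool" where "sq x \<longleftrightarrow> (\<exists>y. x = y ^ 2)"

lemma sq_mult: "sq x \<Longrightarrow> sq y \<Longrightarrow> sq (x * y)"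
  unfolding sq_def by (metis power_mult_distrib)

lemma sq_divide: "sq x \<Longrightarrow> sq y \<Longrightarrow> sq (x / y)"
  unfolding sq_def by (metis power_divide)

lemma card_nonzero_squares:
  assumes "(2 :: 'a :: {field, finite}) \<noteq> 0"
  shows "2 * card {x :: 'a. x \<noteq> 0 \<and> sq x} = CARD('a) - 1"
proof -
  have "{x :: 'a. x ^ 2 = 1} = {1, -1}" by (auto simp: power2_eq_1_iff)
  moreover have "(1 :: 'a) \<noteq> -1"
    using assms by (metis add.right_inverse one_add_one)
  ultimately have "card {x :: 'a. x ^ 2 = 1} = 2" by simp
  moreover have "(\<lambda>x :: 'a. x ^ 2) ` (- {0}) = {x. x \<noteq> 0 \<and> sq x}"
    by (auto simp: sq_def)
  ultimately show ?thesis
    using card_powers_mult_card_roots_of_unity[of 2, where 'a = 'a] by simp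
qed

text \<open>
  The nonzero squares fill half of the nonzero elements, so a multiple of them by a
  nonsquare is exactly the other half.
\<close>
lemma nonsquare_mult:
  fixes x y :: "'a :: {field, finite}"
  assumes "(2 :: 'a) \<noteq> 0" and x: "\<not> sq x" and y: "\<not> sq y"
  shows "sq (x * y)"
proof (rule ccontr)
  assume xy: "\<not> sq (x * y)"
  define Q where "Q = {x :: 'a. x \<noteq> 0 \<and> sq x}"
  have x0: "x \<noteq> 0" and y0: "y \<noteq> 0" using x y by (auto simp: sq_def)
  have "card ((*) x ` Q) = card Q" by (rule card_image) (use x0 in \<open>auto intro: inj_onI\<close>)
  moreover have "Q \<inter> (*) x ` Q = {}"
  proof (rule ccontr)
    assume "Q \<inter> (*) x ` Q \<noteq> {}"
    then obtain s where "s \<in> Q" "x * s \<in> Q" by auto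
    then have "sq (x * s / s)" "s \<noteq> 0" unfolding Q_def using sq_divide by blast+
    then show False using x by simp
  qed
  ultimately have "card (Q \<union> (*) x ` Q) = 2 * card Q" by (simp add: card_Un_disjoint)
  then have "card (Q \<union> (*) x ` Q) = card (- {0 :: 'a})"
    using card_nonzero_squares[OF assms(1)] by (simp add: Q_def card_nonzero)
  then have cover: "Q \<union> (*) x ` Q = - {0}"
    by (intro card_subset_eq) (use x0 in \<open>auto simp: Q_def\<close>)
  then have "y \<in> (*) x ` Q" "x * y \<in> (*) x ` Q"
    using x0 y0 y xy by (auto simp: Q_def)
  then show False using x0 y by (auto simp: Q_def)
qed

lemma exists_nonsquare:
  assumes "(2 :: 'a :: {field, finite}) \<noteq> 0"
  shows "\<exists>n :: 'a. \<not> sq n"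
proof (rule ccontr)
  assume "\<not> ?thesis"
  then have "{x :: 'a. x \<noteq> 0 \<and> sq x} = - {0}" by auto
  then have "2 * (CARD('a) - 1) = CARD('a) - 1"
    using card_nonzero_squares[OF assms] by (simp add: card_nonzero)
  moreover have "CARD('a) > 1"
    by (rule card_field_gt_1)
  ultimately show False by simp
qed

text \<open>
  The values \<open>p \<noteq> 0\<close> of \<open>1 - u ^ 2\<close> are those for which \<open>1 - p\<close> is a square, and
  there are exactly half as many of them as there are nonzero elements. If \<open>p\<close> and \<open>a / p\<close>
  are never both such values, then these values and their images under \<open>p \<mapsto> a / p\<close>
  are two disjoint halves, so that of \<open>p\<close> and \<open>a / p\<close> exactly one is a value.
\<close>
lemma exactly_one_square:
  fixes a p :: "'a :: {field, finite}"
  assumes two: "(2 :: 'a) \<noteq> 0" and a: "a \<noteq> 0" and p: "p \<noteq> 0"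
    and unsolvable: "\<nexists>u v. (1 - u ^ 2) * (1 - v ^ 2) = a"
  shows "sq (1 - a / p) \<longleftrightarrow> \<not> sq (1 - p)"
proof -
  define P where "P = {p :: 'a. p \<noteq> 0 \<and> sq (1 - p)}"
  define Q where "Q = {x :: 'a. sq x}"
  have disj: "P \<inter> (/) a ` P = {}"
  proof (rule ccontr)
    assume "P \<inter> (/) a ` P \<noteq> {}"
    then obtain r where r: "r \<noteq> 0" "sq (1 - r)" "sq (1 - a / r)"
      using a by (auto simp: P_def)
    then obtain u v where "1 - r = u ^ 2" "1 - a / r = v ^ 2" by (auto simp: sq_def)
    then have "1 - u ^ 2 = r" "1 - v ^ 2 = a / r" by (auto simp: algebra_simps)
    then have "(1 - u ^ 2) * (1 - v ^ 2) = a" using r by simp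
    then show False using unsolvable by blast
  qed
  have "P = (\<lambda>x. 1 - x) ` (Q - {1})" by (force simp: P_def Q_def image_iff)
  then have "card P = card (Q - {1})" by (simp add: card_image)
  also have "\<dots> = card (Q - {0})"
  proof -
    have "1 \<in> Q" "0 \<in> Q" by (auto simp: Q_def sq_def intro: exI[of _ 0] exI[of _ 1])
    then show ?thesis by (simp add: card_Diff_singleton)
  qed
  also have "Q - {0} = {x. x \<noteq> 0 \<and> sq x}" by (auto simp: Q_def)
  finally have "2 * card P = card (- {0 :: 'a})"
    using card_nonzero_squares[OF two] by (simp add: card_nonzero)
  moreover have "card ((/) a ` P) = card P"
    by (rule card_image) (use a in \<open>auto intro!: inj_onI simp: P_def field_simps\<close>)
  ultimately have "card (P \<union> (/) a ` P) = card (- {0 :: 'a})"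
    using disj by (simp add: card_Un_disjoint)
  then have cover: "P \<union> (/) a ` P = - {0}"
    by (intro card_subset_eq) (use a in \<open>auto simp: P_def\<close>)
  have "p \<in> (/) a ` P \<longleftrightarrow> sq (1 - a / p)"
  proof
    assume "sq (1 - a / p)"
    then have "a / p \<in> P" using a p by (simp add: P_def)
    then have "a / (a / p) \<in> (/) a ` P" by blast
    then show "p \<in> (/) a ` P" using a p by simp
  qed (use a in \<open>auto simp: P_def\<close>)
  moreover have "p \<in> P \<longleftrightarrow> sq (1 - p)" using p by (simp add: P_def)
  moreover have "p \<in> P \<union> (/) a ` P" using cover p by simp
  ultimately show ?thesis using disj by blast
qed

text \<open>
  The factors are \<open>1 - u\<close> and \<open>1 + u\<close>, with sum 2, and \<open>- (1 - v)\<close> and \<open>- (1 + v)\<close>, with sum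
  \<open>- 2\<close>.
\<close>
lemma balanced_4_if_solvable:
  fixes u v :: "'a :: comm_ring_1"
  shows "balanced 4 ((1 - u ^ 2) * (1 - v ^ 2))"
  by (rule balancedI[of "[1 - u, 1 + u, - (1 - v), - (1 + v)]"])
    (simp_all add: power2_eq_square algebra_simps)

text \<open>
  Otherwise the polynomial \<open>x ^ 4 - 1\<close> would have all nonzero elements as roots.
\<close>
lemma exists_fourth_power_neq_1:
  assumes "(2 :: 'a :: {field, finite}) \<noteq> 0" and "CARD('a) \<notin> {3, 5}"
  shows "\<exists>s :: 'a. s \<noteq> 0 \<and> s ^ 4 \<noteq> 1"
proof (rule ccontr)
  assume "\<not> ?thesis"
  then have roots: "{x :: 'a. x ^ 4 = 1} = - {0}" by (auto simp: power_0_left)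
  let ?p = "monom 1 4 - 1 :: 'a poly"
  have "coeff ?p 4 = 1" by (simp add: coeff_1)
  then have "?p \<noteq> 0" by (metis coeff_0 zero_neq_one)
  moreover have "degree ?p \<le> 4"
    by (intro degree_diff_le) (auto simp: degree_monom_le)
  ultimately have "card {x :: 'a. poly ?p x = 0} \<le> 4"
    using card_poly_roots_bound[of ?p] by simp
  then have "card (- {0 :: 'a}) \<le> 4"
    using roots by (simp add: poly_monom)
  moreover have "odd CARD('a)"
    using card_nonzero_squares[OF assms(1)]
    by (metis One_nat_def dvd_triv_left even_Suc Suc_pred zero_less_card_finite)
  moreover have "CARD('a) > 1"
    by (rule card_field_gt_1)
  ultimately have "CARD('a) \<le> 5" "odd CARD('a)" "CARD('a) > 1" by (auto simp: card_nonzero)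
  then have "CARD('a) \<in> {2, 3, 4, 5}" by auto
  with \<open>odd CARD('a)\<close> have "CARD('a) \<in> {3, 5}" by auto
  then show False using assms by blast
qed

text \<open>
  If \<open>a \<noteq> 0\<close> is not balanced, then neither is \<open>b = s ^ 4 * a\<close>, and \<open>s\<close> can be chosen
  with \<open>b \<noteq> a\<close>. Both equations \<open>(1 - u ^ 2) * (1 - v ^ 2) = a\<close> and
  \<open>(1 - u ^ 2) * (1 - v ^ 2) = b\<close> are then unsolvable, so for each \<open>p \<noteq> 0\<close> the
  elements \<open>1 - a / p\<close> and \<open>1 - b / p\<close> are squares or nonsquares together, depending on
  \<open>1 - p\<close>. Hence \<open>(p - a) * (p - b)\<close> is always a square, which is absurd, since
  \<open>(p - b) / (p - a)\<close> can be given any nonsquare value \<open>n\<close>.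
\<close>
lemma balanced_4:
  fixes a :: "'a :: {field, finite}"
  assumes two: "(2 :: 'a) \<noteq> 0" and card: "CARD('a) \<notin> {3, 5}"
  shows "balanced 4 a"
proof (cases "a = 0")
  case a: False
  obtain s :: 'a where s: "s \<noteq> 0" "s ^ 4 \<noteq> 1"
    using exists_fourth_power_neq_1[OF two card] by blast
  define b where "b = s ^ 4 * a"
  have b: "b \<noteq> 0" "a \<noteq> b" using a s by (auto simp: b_def)
  show ?thesis
  proof (rule ccontr)
    assume unbalanced: "\<not> balanced 4 a"
    then have una: "\<nexists>u v. (1 - u ^ 2) * (1 - v ^ 2) = a"
      using balanced_4_if_solvable by blast
    have "(inverse s) ^ 4 * b = a" using s by (simp add: b_def field_simps)
    then have unb: "\<nexists>u v. (1 - u ^ 2) * (1 - v ^ 2) = b"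
      using unbalanced balanced_4_if_solvable balanced_scale by metis
    obtain n :: 'a where n: "\<not> sq n" using exists_nonsquare[OF two] by blast
    have n01: "n \<noteq> 0" "n \<noteq> 1"
      using n by (auto simp: sq_def) (metis power_one)
    (* the solution p of p - b = n * (p - a) *)
    define p where "p = (n * a - b) / (n - 1)"
    (* p = 0 would give n = b / a, a fourth power *)
    have "n * a - b \<noteq> 0"
    proof
      assume "n * a - b = 0"
      then have "n = (s ^ 2) ^ 2" using a by (simp add: b_def flip: power_mult)
      then show False using n unfolding sq_def by blast
    qed
    then have p: "p \<noteq> 0" using n01 by (simp add: p_def)
    have ratio: "p - b = n * (p - a)"
      using n01 by (simp add: p_def field_simps)
    have pa: "p \<noteq> a" using ratio b by auto
    have "sq (1 - a / p) \<longleftrightarrow> sq (1 - b / p)"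
      using exactly_one_square[OF two a p una] exactly_one_square[OF two b(1) p unb] by simp
    then have "sq ((1 - a / p) * (1 - b / p))"
      using sq_mult nonsquare_mult[OF two] by blast
    moreover have "1 - b / p = n * (1 - a / p)"
      using ratio p by (simp add: field_simps)
    then have "(1 - a / p) * (1 - b / p) = n * (1 - a / p) ^ 2"
      by (simp add: power2_eq_square)
    ultimately have "sq (n * (1 - a / p) ^ 2 / (1 - a / p) ^ 2)"
      by (metis sq_def sq_divide)
    then show False using n pa p by simp
  qed
qed (simp add: balanced_0)

section \<open>Three factors and sums of two cubes\<close>

definition cubes :: "'a :: field set" where
  "cubes = (\<lambda>x. x ^ 3) ` (- {0})"

lemma cubes_neq_0: "x \<in> cubes \<Longrightarrow> x \<noteq> 0"
  by (auto simp: cubes_def)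

lemma one_in_cubes: "1 \<in> cubes"
  by (auto simp: cubes_def intro!: image_eqI[of _ _ 1])

lemma cubes_mult: "x \<in> cubes \<Longrightarrow> y \<in> cubes \<Longrightarrow> x * y \<in> cubes"
  unfolding cubes_def by (force simp flip: power_mult_distrib)

lemma cubes_divide: "x \<in> cubes \<Longrightarrow> y \<in> cubes \<Longrightarrow> x / y \<in> cubes"
  unfolding cubes_def by (force simp flip: power_divide)

lemma cubes_uminus: "x \<in> cubes \<Longrightarrow> - x \<in> cubes"
  unfolding cubes_def by (force intro: image_eqI[where x = "- y" for y])

lemma cube_in_cubes: "x \<noteq> 0 \<Longrightarrow> x ^ 3 \<in> cubes"
  by (auto simp: cubes_def)

lemma sum_cubes_mult:
  fixes c :: "'a :: field"
  assumes "c \<in> cubes"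
  shows "(\<Sum>s\<in>cubes. f (c * s)) = (\<Sum>s\<in>cubes. f s)"
  by (rule sum.reindex_bij_witness[of _ "\<lambda>s. s / c" "\<lambda>s. c * s"])
    (use assms cubes_neq_0 in \<open>auto intro: cubes_mult cubes_divide\<close>)

lemma sum_cubes_inverse: "(\<Sum>s\<in>cubes. f (1 / s)) = (\<Sum>s\<in>cubes. f (s :: 'a :: field))"
  by (rule sum.reindex_bij_witness[of _ "\<lambda>s. 1 / s" "\<lambda>s. 1 / s"])
    (auto intro: cubes_divide one_in_cubes)

text \<open>
  The number of pairs \<open>(s, t)\<close> of nonzero cubes with \<open>u * s + v * t = w\<close>; for \<open>u\<close>, \<open>v\<close>, \<open>w\<close>
  ranging over powers of a noncube these are, up to notation, the classical cyclotomic
  numbers of order 3. It is a double sum because all the symmetries below are then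
  reindexings of sums.
\<close>
definition cyclotomic :: "'a :: field \<Rightarrow> 'a \<Rightarrow> 'a \<Rightarrow> nat" where
  "cyclotomic u v w = (\<Sum>s\<in>cubes. \<Sum>t\<in>cubes. of_bool (u * s + v * t = w))"

lemma cyclotomic_commute: "cyclotomic u v w = cyclotomic v u w"
  unfolding cyclotomic_def by (subst sum.swap) (simp add: add.commute)

text \<open>
  Dividing \<open>u * s + v * t = w\<close> by the cube \<open>s\<close> exchanges the roles of \<open>u\<close> and \<open>w\<close>; the sign
  is harmless because \<open>-1\<close> is a cube. Together with \<open>cyclotomic_commute\<close> this makes the
  number symmetric in all three arguments.
\<close>
lemma cyclotomic_rotate: "cyclotomic u v w = cyclotomic w v u"
proof -
  have "cyclotomic u v w = (\<Sum>s\<in>cubes. \<Sum>t\<in>cubes. of_bool (u * s + v * (- s * t) = w))"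
    unfolding cyclotomic_def
  proof (rule sum.cong[OF refl])
    fix s :: 'a assume "s \<in> cubes"
    then have "- s \<in> cubes" by (rule cubes_uminus)
    from sum_cubes_mult[OF this, of "\<lambda>t. of_bool (u * s + v * t = w) :: nat"]
    show "(\<Sum>t\<in>cubes. of_bool (u * s + v * t = w)) =
      (\<Sum>t\<in>cubes. of_bool (u * s + v * (- s * t) = w) :: nat)" by simp
  qed
  also have "\<dots> = (\<Sum>s\<in>cubes. \<Sum>t\<in>cubes. of_bool (w * (1 / s) + v * t = u))"
  proof (intro sum.cong refl arg_cong[where f = of_bool])
    fix s t :: 'a assume "s \<in> cubes"
    then have "s \<noteq> 0" by (rule cubes_neq_0)
    then show "u * s + v * (- s * t) = w \<longleftrightarrow> w * (1 / s) + v * t = u"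
      by (auto simp: field_simps)
  qed
  also have "\<dots> = cyclotomic w v u"
    unfolding cyclotomic_def
    by (rule sum_cubes_inverse[where f = "\<lambda>s. \<Sum>t\<in>cubes. of_bool (w * s + v * t = u)"])
  finally show ?thesis .
qed

lemma cyclotomic_scale:
  assumes "c \<noteq> 0"
  shows "cyclotomic (c * u) (c * v) (c * w) = cyclotomic u v w"
proof -
  have "c * u * s + c * v * t = c * w \<longleftrightarrow> u * s + v * t = w" for s t
    using assms by (metis distrib_left mult.assoc mult_left_cancel)
  then show ?thesis unfolding cyclotomic_def by simp
qed

lemma cyclotomic_absorb:
  assumes "c \<in> cubes"
  shows "cyclotomic (c * u) v w = cyclotomic u v w"
  unfolding cyclotomic_def
  using sum_cubes_mult[OF assms, of "\<lambda>s. \<Sum>t\<in>cubes. of_bool (u * s + v * t = w) :: nat"]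
  by (simp add: ac_simps)

lemma cyclotomic_absorb_target:
  assumes "c \<in> cubes"
  shows "cyclotomic u v (c * w) = cyclotomic u v w"
  using cyclotomic_absorb[OF assms] cyclotomic_rotate by metis

lemma cyclotomic_neq_0_imp:
  assumes "cyclotomic u v w \<noteq> 0"
  shows "\<exists>s\<in>cubes. \<exists>t\<in>cubes. u * s + v * t = w"
proof (rule ccontr)
  assume "\<not> ?thesis"
  then have "cyclotomic u v w = 0" unfolding cyclotomic_def by (intro sum.neutral ballI) auto
  then show False using assms by simp
qed

lemma cyclotomic_0:
  fixes u :: "'a :: {field, finite}"
  assumes "u \<noteq> 0"
  shows "cyclotomic u u 0 = card (cubes :: 'a set)"
proof -
  have "(\<Sum>t\<in>cubes. of_bool (u * s + u * t = 0)) = (1 :: nat)" if s: "s \<in> cubes" for s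
  proof -
    have "u * s + u * t = 0 \<longleftrightarrow> t = - s" for t
      using assms by (metis add_eq_0_iff distrib_left mult_eq_0_iff)
    then show ?thesis using cubes_uminus[OF s] by (simp add: of_bool_def)
  qed
  then show ?thesis unfolding cyclotomic_def by simp
qed

text \<open>
  Without a nontrivial cube root of unity, cubing would be injective and hence surjective.
\<close>
lemma cube_roots_of_unity:
  assumes g: "g \<noteq> 0" "(g :: 'a :: {field, finite}) \<notin> cubes"
  shows "\<exists>\<omega> :: 'a. \<omega> ^ 2 + \<omega> + 1 = 0" and "card {x :: 'a. x ^ 3 = 1} = 3"
proof -
  have "card {x :: 'a. x ^ 3 = 1} \<noteq> 1"
  proof
    assume "card {x :: 'a. x ^ 3 = 1} = 1"
    then have "card (cubes :: 'a set) = card (- {0 :: 'a})"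
      using card_powers_mult_card_roots_of_unity[of 3, where 'a = 'a]
      by (simp add: cubes_def card_nonzero)
    moreover have "cubes \<subseteq> - {0 :: 'a}" by (auto simp: cubes_def)
    ultimately have "cubes = - {0 :: 'a}" by (intro card_subset_eq) auto
    then show False using g by auto
  qed
  then have "{x :: 'a. x ^ 3 = 1} \<noteq> {1}" by auto
  then obtain \<omega> :: 'a where w: "\<omega> ^ 3 = 1" "\<omega> \<noteq> 1" by force
  have "\<omega> ^ 3 - 1 = (\<omega> - 1) * (\<omega> ^ 2 + \<omega> + 1)"
    by (simp add: algebra_simps power2_eq_square power3_eq_cube)
  then have quad: "\<omega> ^ 2 + \<omega> + 1 = 0" using w by simp
  then show "\<exists>\<omega> :: 'a. \<omega> ^ 2 + \<omega> + 1 = 0" using w by blast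
  have factor: "x ^ 3 - 1 = (x - 1) * (x - \<omega>) * (x - \<omega> ^ 2)" for x
  proof -
    have w2: "\<omega> ^ 2 = - \<omega> - 1" using quad by (simp add: eq_neg_iff_add_eq_0 add.assoc algebra_simps)
    have "(x - 1) * (x - \<omega>) * (x - \<omega> ^ 2)
      = x ^ 3 - x ^ 2 * (1 + \<omega> + \<omega> ^ 2) + x * (\<omega> + \<omega> ^ 2 + \<omega> ^ 3) - \<omega> ^ 3"
      by (simp add: algebra_simps power2_eq_square power3_eq_cube)
    also have "\<dots> = x ^ 3 - 1"
      using w(1) by (simp add: w2)
    finally show ?thesis by simp
  qed
  have "x ^ 3 = 1 \<longleftrightarrow> x = 1 \<or> x = \<omega> \<or> x = \<omega> ^ 2" for x
    using factor[of x] by (auto simp: right_minus_eq)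
  then have "{x. x ^ 3 = 1} = {1, \<omega>, \<omega> ^ 2}" by auto
  moreover have "\<omega> \<noteq> \<omega> ^ 2"
    using w by (auto simp: power2_eq_square)
  moreover have "\<omega> ^ 2 \<noteq> 1"
    using w by (metis mult_1 power2_eq_square power3_eq_cube)
  ultimately show "card {x :: 'a. x ^ 3 = 1} = 3" using w by auto
qed

lemma card_cubes:
  assumes "g \<noteq> 0" "(g :: 'a :: {field, finite}) \<notin> cubes"
  shows "3 * card (cubes :: 'a set) = CARD('a) - 1"
  using card_powers_mult_card_roots_of_unity[of 3, where 'a = 'a] cube_roots_of_unity[OF assms]
  by (simp add: cubes_def)

lemma cosets_of_cubes_disjoint:
  assumes "g \<noteq> 0" "g \<notin> cubes"
  shows "x \<in> cubes \<Longrightarrow> x / g \<notin> cubes" "x \<in> cubes \<Longrightarrow> x / g ^ 2 \<notin> cubes"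
    "x / g \<in> cubes \<Longrightarrow> x / g ^ 2 \<notin> cubes"
proof -
  have g3: "g ^ 3 \<in> cubes" using assms by (simp add: cube_in_cubes)
  show "x / g \<notin> cubes" if "x \<in> cubes"
  proof
    assume "x / g \<in> cubes"
    then have "x / (x / g) \<in> cubes" using that cubes_divide by blast
    then show False using assms cubes_neq_0[OF that] by simp
  qed
  show "x / g ^ 2 \<notin> cubes" if "x \<in> cubes"
  proof
    assume "x / g ^ 2 \<in> cubes"
    then have "g ^ 3 / (x / (x / g ^ 2)) \<in> cubes" using that cubes_divide g3 by blast
    then show False using assms cubes_neq_0[OF that]
      by (auto simp: power2_eq_square power3_eq_cube field_simps)
  qed
  show "x / g ^ 2 \<notin> cubes" if "x / g \<in> cubes"
  proof
    assume *: "x / g ^ 2 \<in> cubes"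
    then have "(x / g) / (x / g ^ 2) \<in> cubes" using that cubes_divide by blast
    moreover have "x \<noteq> 0" using cubes_neq_0[OF *] by auto
    ultimately show False using assms
      by (auto simp: power2_eq_square)
  qed
qed

text \<open>
  The three cosets \<open>cubes\<close>, \<open>g * cubes\<close> and \<open>g ^ 2 * cubes\<close> are disjoint, and each contains
  a third of the nonzero elements.
\<close>
lemma cosets_of_cubes_cover:
  fixes x :: "'a :: {field, finite}"
  assumes "g \<noteq> 0" "g \<notin> cubes" "x \<noteq> 0"
  shows "x \<in> cubes \<or> x / g \<in> cubes \<or> x / g ^ 2 \<in> cubes"
proof -
  note [simp] = assms(1)
  have im: "(*) c ` cubes = {x. x / c \<in> cubes}" if "c \<noteq> 0" for c :: 'a
    using that by (auto simp: image_iff intro!: bexI[of _ "x / c" for x])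
  have card: "card {x. x / c \<in> cubes} = card (cubes :: 'a set)" if "c \<noteq> 0" for c :: 'a
    unfolding im[OF that, symmetric] by (rule card_image) (use that in \<open>auto intro: inj_onI\<close>)
  have "card (cubes \<union> {x. x / g \<in> cubes} \<union> {x. x / g ^ 2 \<in> cubes}) = 3 * card (cubes :: 'a set)"
  proof (subst card_Un_disjoint)
    show "card (cubes \<union> {x. x / g \<in> cubes}) + card {x. x / g ^ 2 \<in> cubes} = 3 * card (cubes :: 'a set)"
      using cosets_of_cubes_disjoint(1)[OF assms(1,2)] card[of g] card[of "g ^ 2"] by (subst card_Un_disjoint) auto
  qed (use cosets_of_cubes_disjoint[OF assms(1,2)] in auto)
  moreover have "cubes \<union> {x. x / g \<in> cubes} \<union> {x. x / g ^ 2 \<in> cubes} \<subseteq> - {0}"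
    by (auto dest: cubes_neq_0)
  ultimately have "cubes \<union> {x. x / g \<in> cubes} \<union> {x. x / g ^ 2 \<in> cubes} = - {0}"
    using card_cubes[OF assms(1,2)] by (intro card_subset_eq) (auto simp: card_nonzero)
  then show ?thesis using assms(3) by auto
qed

text \<open>
  A function that is constant on the cosets of the cubes is summed over \<open>w - v * s\<close> by
  sorting the cubes \<open>s\<close> according to the coset in which \<open>w - v * s\<close> lies. With a constant
  function this counts all cubes; with a cyclotomic number as a function of its target it
  counts triples of cubes.
\<close>
lemma sum_cubes_class_function:
  fixes v w g :: "'a :: {field, finite}" and \<phi> :: "'a \<Rightarrow> nat"
  assumes g: "g \<noteq> 0" "g \<notin> cubes" and v: "v \<noteq> 0"
    and \<phi>: "\<And>c x. c \<in> cubes \<Longrightarrow> \<phi> (c * x) = \<phi> x"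
  shows "(\<Sum>s\<in>cubes. \<phi> (w - v * s)) = of_bool (w / v \<in> cubes) * \<phi> 0
    + cyclotomic v 1 w * \<phi> 1 + cyclotomic v g w * \<phi> g + cyclotomic v (g ^ 2) w * \<phi> (g ^ 2)"
proof -
  have coset: "(\<Sum>t\<in>cubes. of_bool (c * t = x)) = (of_bool (x / c \<in> cubes) :: nat)"
    if "c \<noteq> 0" for c x :: 'a
  proof -
    have "c * t = x \<longleftrightarrow> t = x / c" for t using that by (auto simp: field_simps)
    then show ?thesis by (simp add: of_bool_def)
  qed
  have count: "cyclotomic v c w = (\<Sum>s\<in>cubes. of_bool ((w - v * s) / c \<in> cubes))" if "c \<noteq> 0" for c
    unfolding cyclotomic_def coset[OF that, symmetric]
    by (intro sum.cong refl arg_cong[where f = of_bool]) (auto simp: algebra_simps)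
  have zero: "of_bool (w / v \<in> cubes) = (\<Sum>s\<in>cubes. of_bool (w - v * s = 0) :: nat)"
    unfolding coset[OF v, symmetric]
    by (intro sum.cong refl arg_cong[where f = of_bool]) auto
  have scale: "\<phi> x = \<phi> c" if "x / c \<in> cubes" "c \<noteq> 0" for x c
    using \<phi>[OF that(1), of c] that(2) by simp
  have pointwise: "\<phi> x = of_bool (x = 0) * \<phi> 0 + of_bool (x / 1 \<in> cubes) * \<phi> 1
      + of_bool (x / g \<in> cubes) * \<phi> g + of_bool (x / g ^ 2 \<in> cubes) * \<phi> (g ^ 2)" for x
  proof (cases "x = 0")
    case True
    moreover have "(0 :: 'a) \<notin> cubes" using cubes_neq_0 by blast
    ultimately show ?thesis by simp
  next
    case False
    then show ?thesis
      using cosets_of_cubes_cover[OF g False] cosets_of_cubes_disjoint[OF g, of x] scale[of x 1] scale[of x g] scale[of x "g ^ 2"] g(1)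
      by auto
  qed
  have "(\<Sum>s\<in>cubes. \<phi> (w - v * s)) = (\<Sum>s\<in>cubes. of_bool (w - v * s = 0) * \<phi> 0
      + of_bool ((w - v * s) / 1 \<in> cubes) * \<phi> 1 + of_bool ((w - v * s) / g \<in> cubes) * \<phi> g
      + of_bool ((w - v * s) / g ^ 2 \<in> cubes) * \<phi> (g ^ 2))"
    by (rule sum.cong[OF refl]) (rule pointwise)
  then show ?thesis
    using g(1) by (simp only: zero count sum.distrib sum_distrib_right one_neq_zero power_not_zero not_False_eq_True)
qed

text \<open>
  Both sides count the triples of cubes with \<open>u * s + v * t + x * z = w\<close>: on the left \<open>z\<close> is
  chosen first, on the right \<open>s\<close>.
\<close>
lemma cyclotomic_sum_swap:
  "(\<Sum>z\<in>cubes. cyclotomic u v (w - x * z)) = (\<Sum>s\<in>cubes. cyclotomic v x (w - u * s))"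
proof -
  have "(\<Sum>z\<in>cubes. cyclotomic u v (w - x * z))
    = (\<Sum>s\<in>cubes. \<Sum>z\<in>cubes. \<Sum>t\<in>cubes. of_bool (u * s + v * t = w - x * z))"
    unfolding cyclotomic_def by (rule sum.swap)
  also have "\<dots> = (\<Sum>s\<in>cubes. \<Sum>t\<in>cubes. \<Sum>z\<in>cubes. of_bool (v * t + x * z = w - u * s))"
  proof (rule sum.cong[OF refl])
    fix s :: 'a
    have "u * s + v * t = w - x * z \<longleftrightarrow> v * t + x * z = w - u * s" for t z
      by (auto simp: algebra_simps)
    then show "(\<Sum>z\<in>cubes. \<Sum>t\<in>cubes. of_bool (u * s + v * t = w - x * z))
      = (\<Sum>t\<in>cubes. \<Sum>z\<in>cubes. of_bool (v * t + x * z = w - u * s) :: nat)"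
      by (subst sum.swap) simp
  qed
  finally show ?thesis unfolding cyclotomic_def .
qed

text \<open>
  Suppose that the noncube \<open>g\<close> is not a sum of two nonzero cubes. By the symmetries, the
  cyclotomic numbers with arguments in \<open>{1, g, g ^ 2}\<close> then take, besides 0, only the values
  \<open>A\<close>, \<open>C\<close> and \<open>D\<close> introduced in the proof. Sorting the \<open>f\<close> nonzero cubes \<open>s\<close> by the cosets
  of \<open>1 - s\<close> and of \<open>g - s\<close> gives \<open>f = 1 + A + C\<close> and \<open>f = C + D\<close>. Counting the solutions of
  \<open>s + t + g * z = g\<close> in two ways gives \<open>f + A * C = C ^ 2 + D ^ 2\<close>. Eliminating \<open>f\<close> and
  \<open>D = A + 1\<close> leaves \<open>(C - A) * (C - A - 1) + A * C = 0\<close>, where both summands are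
  nonnegative. This forces \<open>A = 0\<close> and \<open>C \<le> 1\<close>, so \<open>f \<le> 2\<close>, and the field, with
  \<open>3 * f + 1\<close> elements, has 4 or 7 of them.
\<close>
lemma noncube_is_sum_of_two_cubes:
  fixes g :: "'a :: {field, finite}"
  assumes g: "g \<noteq> 0" "g \<notin> cubes" and card: "CARD('a) \<notin> {4, 7}"
  shows "\<exists>s\<in>cubes. \<exists>t\<in>cubes. s + t = g"
proof (rule ccontr)
  assume none: "\<not> ?thesis"
  have B: "cyclotomic 1 1 g = 0"
    using cyclotomic_neq_0_imp[of 1 1 g] none by auto
  define f where "f = card (cubes :: 'a set)"
  define A C D where "A = cyclotomic 1 1 (1 :: 'a)" and "C = cyclotomic 1 1 (g ^ 2)" and "D = cyclotomic 1 g (g ^ 2)"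
  have g3: "g ^ 3 \<in> cubes" using g by (simp add: cube_in_cubes)
  have C1: "cyclotomic 1 (g ^ 2) 1 = C"
    unfolding C_def by (metis cyclotomic_commute cyclotomic_rotate)
  have C2: "cyclotomic 1 g g = C"
  proof -
    have "cyclotomic 1 g g = cyclotomic (g ^ 2 * 1) (g ^ 2 * g) (g ^ 2 * g)"
      using g by (simp only: cyclotomic_scale power_not_zero not_False_eq_True)
    also have "\<dots> = cyclotomic (g ^ 3 * 1) (g ^ 2) (g ^ 3 * 1)"
      by (subst cyclotomic_commute) (simp add: power2_eq_square power3_eq_cube)
    also have "\<dots> = cyclotomic 1 (g ^ 2) 1"
      using g3 by (simp only: cyclotomic_absorb cyclotomic_absorb_target)
    finally show ?thesis using C1 by simp
  qed
  have D1: "cyclotomic 1 (g ^ 2) g = D"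
    unfolding D_def by (metis cyclotomic_commute cyclotomic_rotate)
  have B1: "cyclotomic 1 g 1 = 0"
    using B by (metis cyclotomic_commute cyclotomic_rotate)
  have g_cube: "g / 1 \<notin> cubes" "1 / 1 \<in> (cubes :: 'a set)" "g / g \<in> cubes"
    using g one_in_cubes by auto
  have row1: "f = 1 + A + C"
    using sum_cubes_class_function[OF g one_neq_zero, of "\<lambda>_. 1" 1] B1 C1 one_in_cubes
    by (simp add: f_def A_def)
  have row2: "f = C + D"
    using sum_cubes_class_function[OF g one_neq_zero, of "\<lambda>_. 1" g] B C2 D1 g
    by (simp add: f_def)
  have coset_inv: "cyclotomic u v (c * x) = cyclotomic u v x" if "c \<in> cubes" for u v c x :: 'a
    using that by (rule cyclotomic_absorb_target)
  have "(\<Sum>z\<in>cubes. cyclotomic 1 1 (g - g * z)) = f + cyclotomic g 1 g * A + cyclotomic g (g ^ 2) g * C"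
    by (subst sum_cubes_class_function[OF g g(1) coset_inv])
      (use g_cube B cyclotomic_0[of "1 :: 'a"] in \<open>auto simp: A_def C_def f_def\<close>)
  also have "cyclotomic g 1 g = C" using C2 cyclotomic_commute by metis
  also have "cyclotomic g (g ^ 2) g = 0"
  proof -
    have "cyclotomic g (g ^ 2) g = cyclotomic (g * 1) (g * g) (g * 1)" by (simp add: power2_eq_square)
    also have "\<dots> = 0" unfolding cyclotomic_scale[OF g(1)] by (rule B1)
    finally show ?thesis .
  qed
  finally have count1: "(\<Sum>z\<in>cubes. cyclotomic 1 1 (g - g * z)) = f + C * A" by simp
  have "(\<Sum>s\<in>cubes. cyclotomic 1 g (g - 1 * s)) = C * C + D * D"
    by (subst sum_cubes_class_function[OF g one_neq_zero coset_inv])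
      (use g B C2 D1 in \<open>auto simp: D_def\<close>)
  then have triple: "f + C * A = C * C + D * D"
    using count1 cyclotomic_sum_swap[of 1 1 g g] by simp
  have D: "D = A + 1" using row1 row2 by simp
  have "C + A * C = C * C + A * A + A"
    using triple row1 D by (simp add: algebra_simps)
  then have eq: "(int C - int A) * (int C - int A - 1) + int A * int C = 0"
    by (simp add: algebra_simps flip: of_nat_add of_nat_mult)
  (* a product of consecutive integers *)
  have nonneg: "(int C - int A) * (int C - int A - 1) \<ge> 0"
    by (cases "int C - int A \<ge> 1") (auto intro: mult_nonneg_nonneg mult_nonpos_nonpos)
  have "int A * int C = 0" "(int C - int A) * (int C - int A - 1) = 0"
    using eq nonneg by (smt (verit) of_nat_0_le_iff mult_nonneg_nonneg)+
  then have "A = 0 \<and> C = 0 \<or> A = 0 \<and> C = 1" by auto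
  then have "f = 1 \<or> f = 2" using row1 by auto
  then have "CARD('a) = 4 \<or> CARD('a) = 7"
    using card_cubes[OF g] zero_less_card_finite[where 'a = 'a] by (auto simp: f_def)
  then show False using card by simp
qed

text \<open>
  If every element is a cube, scaling a single decomposition with nonzero product is enough.
  Otherwise there is a primitive cube root of unity \<open>\<omega>\<close>, and \<open>x ^ 3 + y ^ 3\<close> is the
  product of the linear forms \<open>x + y\<close>, \<open>\<omega> * x + \<omega> ^ 2 * y\<close> and
  \<open>\<omega> ^ 2 * x + \<omega> * y\<close>, whose sum is zero; so it suffices that every element is
  a sum of two cubes, one of which may be 0.
\<close>
lemma balanced_3:
  fixes a :: "'a :: {field, finite}"
  assumes card: "CARD('a) \<notin> {2, 4, 7}"
  shows "balanced 3 a"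
proof (cases "a = 0")
  case a: False
  show ?thesis
  proof (cases "cubes = - {0 :: 'a}")
    case True
    obtain t :: 'a where t: "t \<noteq> 0" "t \<noteq> -1"
      using exists_avoiding_two[of 0 "- 1 :: 'a"] card by auto
    then have nz: "- (t * (1 + t)) \<noteq> 0" by (auto simp: add_eq_0_iff)
    have "balanced 3 (- (t * (1 + t)))"
      by (rule balancedI[of "[1, t, - (1 + t)]"]) (auto simp: algebra_simps)
    moreover have "a / (- (t * (1 + t))) \<in> cubes"
      unfolding True using a nz by simp
    then obtain x where "x ^ 3 = a / (- (t * (1 + t)))"
      unfolding cubes_def by (metis imageE)
    then have "x ^ 3 * (- (t * (1 + t))) = a" using nz by simp
    ultimately show ?thesis using balanced_scale by metis
  next
    case False
    moreover have "(cubes :: 'a set) \<subseteq> - {0}" by (auto dest: cubes_neq_0)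
    ultimately obtain g :: 'a where g: "g \<noteq> 0" "g \<notin> cubes" by blast
    then obtain \<omega> :: 'a where w: "\<omega> ^ 2 + \<omega> + 1 = 0" using cube_roots_of_unity(1) by blast
    have w2: "\<omega> ^ 2 = - \<omega> - 1" using w by (simp add: eq_neg_iff_add_eq_0 add.assoc algebra_simps)
    obtain x y where xy: "a = x ^ 3 + y ^ 3"
    proof (cases "a \<in> cubes")
      case True
      then obtain x where "a = x ^ 3" unfolding cubes_def by blast
      then show ?thesis using that[of x 0] by simp
    next
      case False
      then have "\<exists>s\<in>cubes. \<exists>t\<in>cubes. s + t = a"
        using noncube_is_sum_of_two_cubes[OF a] card by simp
      then show ?thesis unfolding cubes_def using that by blast
    qed
    show ?thesis
    proof (rule balancedI)
      show "length [x + y, \<omega> * x + \<omega> ^ 2 * y, \<omega> ^ 2 * x + \<omega> * y] = 3" by simp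
      have "x + y + (\<omega> * x + \<omega> ^ 2 * y) + (\<omega> ^ 2 * x + \<omega> * y) = (\<omega> ^ 2 + \<omega> + 1) * (x + y)"
        by (simp add: algebra_simps)
      then show "sum_list [x + y, \<omega> * x + \<omega> ^ 2 * y, \<omega> ^ 2 * x + \<omega> * y] = 0"
        using w by (simp add: add.assoc)
      have "\<omega> * \<omega> ^ 2 = \<omega> * (- \<omega> - 1)" using w2 by simp
      also have "\<dots> = - (\<omega> ^ 2) - \<omega>" by (simp add: power2_eq_square algebra_simps)
      also have "\<dots> = 1" by (simp add: w2)
      finally have w3: "\<omega> * \<omega> ^ 2 = 1" .
      have "(\<omega> * x + \<omega> ^ 2 * y) * (\<omega> ^ 2 * x + \<omega> * y)
        = \<omega> * \<omega> ^ 2 * x ^ 2 + (\<omega> ^ 2 + \<omega> * (\<omega> * \<omega> ^ 2)) * x * y + \<omega> * \<omega> ^ 2 * y ^ 2"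
        by (simp add: power2_eq_square algebra_simps)
      also have "\<dots> = x ^ 2 - x * y + y ^ 2"
        unfolding w3 by (simp add: w2 algebra_simps)
      finally have last_two: "(\<omega> * x + \<omega> ^ 2 * y) * (\<omega> ^ 2 * x + \<omega> * y) = x ^ 2 - x * y + y ^ 2" .
      have "(x + y) * (x ^ 2 - x * y + y ^ 2) = a"
        by (simp add: xy power2_eq_square power3_eq_cube algebra_simps)
      then show "prod_list [x + y, \<omega> * x + \<omega> ^ 2 * y, \<omega> ^ 2 * x + \<omega> * y] = a"
        by (simp only: prod_list.Cons prod_list.Nil mult_1_right last_two)
    qed
  qed
qed (simp add: balanced_0)

section \<open>Two factors\<close>

lemma balanced_2_iff: "balanced 2 a \<longleftrightarrow> (\<exists>x. a = - (x ^ 2))" for a :: "'a :: comm_ring_1"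
proof
  assume "balanced 2 a"
  then obtain x y where "a = x * y" "x + y = 0"
    unfolding balanced_def by (auto simp: numeral_2_eq_2 length_Suc_conv)
  moreover from this have "y = - x" by (simp add: eq_neg_iff_add_eq_0 add.commute)
  ultimately have "a = - (x ^ 2)" by (simp add: power2_eq_square)
  then show "\<exists>x. a = - (x ^ 2)" ..
next
  assume "\<exists>x. a = - (x ^ 2)"
  then obtain x where "a = - (x ^ 2)" ..
  then show "balanced 2 a"
    by (intro balancedI[of "[x, - x]"]) (auto simp: power2_eq_square)
qed

lemma all_balanced_2_iff:
  "(\<forall>a :: 'a :: {field, finite}. balanced 2 a) \<longleftrightarrow> (2 :: 'a) = 0"
proof
  assume all: "\<forall>a :: 'a. balanced 2 a"
  show "(2 :: 'a) = 0"
  proof (rule ccontr)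
    assume "(2 :: 'a) \<noteq> 0"
    then obtain n :: 'a where n: "\<not> sq n" using exists_nonsquare by blast
    have "balanced 2 (- n)" using all by blast
    then show False using n by (auto simp: balanced_2_iff sq_def)
  qed
next
  assume two: "(2 :: 'a) = 0"
  have neg: "- x = x" for x :: 'a
    using two by (metis add_eq_0_iff2 mult_2 mult_zero_left)
  have "inj (\<lambda>x :: 'a. x ^ 2)"
  proof (rule injI)
    fix x y :: 'a assume "x ^ 2 = y ^ 2"
    then show "x = y" using neg[of y] by (simp add: power2_eq_iff)
  qed
  then have "surj (\<lambda>x :: 'a. x ^ 2)" by (simp add: finite_UNIV_inj_surj)
  then have "\<exists>x. a = x ^ 2" for a :: 'a
    by (rule surjD)
  then have "\<exists>x. a = - (x ^ 2)" for a :: 'a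
    by (simp only: neg)
  then show "\<forall>a :: 'a. balanced 2 a"
    unfolding balanced_2_iff by blast
qed

section \<open>Small fields\<close>

text \<open>
  If \<open>k\<close> is invertible modulo the order \<open>CARD('a) - 1\<close> of the multiplicative group, then
  every element is a \<open>k\<close>-th power, and one decomposition with nonzero product can be scaled
  to all others.
\<close>
lemma balanced_if_exponent_invertible:
  fixes a b :: "'a :: {field, finite}"
  assumes "balanced k b" "b \<noteq> 0" and km: "k * m = Suc ((CARD('a) - 1) * d)"
  shows "balanced k a"
proof (cases "a = 0")
  case False
  define x where "x = (a / b) ^ m"
  have "x ^ k = (a / b) ^ Suc ((CARD('a) - 1) * d)"
    unfolding x_def by (simp only: mult.commute[of m k] km flip: power_mult)
  also have "\<dots> = a / b"
    using power_card_minus_1[of "a / b"] False assms(2) by (simp add: power_mult)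
  finally have "x ^ k * b = a" using assms(2) by simp
  then show ?thesis using balanced_scale[OF assms(1), of x] by simp
next
  case True
  then show ?thesis using km by (cases k) (auto intro: balanced_0)
qed

lemma prime_2_3_5_7: "prime (2 :: nat)" "prime (3 :: nat)" "prime (5 :: nat)" "prime (7 :: nat)"
  by (simp_all add: prime_nat_numeral_eq)

lemma card_2_balanced_iff:
  assumes card: "CARD('a :: {field, finite}) = 2"
  shows "(\<forall>a :: 'a. balanced k a) \<longleftrightarrow> even k \<and> k \<noteq> 0"
proof
  assume all: "\<forall>a :: 'a. balanced k a"
  have bit: "x = 0 \<or> x = 1" for x :: 'a
    using prime_field_elements(2)[of x] card prime_2_3_5_7 by (auto simp: less_2_cases_iff)
  obtain xs :: "'a list" where xs: "length xs = k" "prod_list xs = 1" "sum_list xs = 0"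
    using all unfolding balanced_def by blast
  then have "0 \<notin> set xs" by (metis prod_list_zero_iff zero_neq_one)
  then have "xs = replicate k 1"
    using xs(1) bit by (metis replicate_eqI)
  then have "of_nat k = (0 :: 'a)" using xs(3) by (simp add: sum_list_replicate)
  then have "even k"
    using prime_field_elements(1)[where 'a = 'a] card prime_2_3_5_7 by (simp add: of_nat_eq_0_iff_char_dvd)
  moreover have "k \<noteq> 0" using all[rule_format, of 0] by (auto simp: balanced_def)
  ultimately show "even k \<and> k \<noteq> 0" ..
next
  assume k: "even k \<and> k \<noteq> 0"
  have "(2 :: 'a) = 0" using of_nat_card_eq_0[where 'a = 'a] card by simp
  then have "\<forall>a :: 'a. balanced 2 a" using all_balanced_2_iff by blast
  moreover have "k \<ge> 2" using k by (cases "k = 1") auto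
  ultimately show "\<forall>a :: 'a. balanced k a" using k balanced_add_even[of 2 k] by auto
qed

text \<open>
  Dividing all factors by the first one leaves, up to a power of that factor, a polynomial
  in fewer variables. In the small fields the power takes few values, so that the elements
  which are not balanced can be read off.
\<close>
lemma balanced_3_nonzeroE:
  fixes a :: "'a :: field"
  assumes "balanced 3 a" "a \<noteq> 0"
  obtains x t where "x \<noteq> 0" "t \<noteq> 0" "t \<noteq> - 1" "a = - (x ^ 3 * (t * (1 + t)))"
proof -
  obtain x y z where xyz: "a = x * (y * z)" "x + (y + z) = 0"
    using assms unfolding balanced_def by (auto simp: numeral_3_eq_3 length_Suc_conv)
  then have "z + (x + y) = 0" by (simp only: ac_simps)
  then have z: "z = - (x + y)" by (simp only: eq_neg_iff_add_eq_0)
  have "x \<noteq> 0" "y \<noteq> 0" "z \<noteq> 0" using xyz(1) assms by auto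
  moreover from this have "x + y \<noteq> 0" unfolding z by (simp only: neg_equal_0_iff_equal not_False_eq_True)
  moreover from this have "a = - (x ^ 3 * (y / x * (1 + y / x)))"
    unfolding xyz z by (simp add: field_simps power3_eq_cube)
  ultimately show ?thesis
    using that[of x "y / x"] by (auto simp: field_simps eq_neg_iff_add_eq_0)
qed

lemma balanced_4_nonzeroE:
  fixes a :: "'a :: field"
  assumes "balanced 4 a" "a \<noteq> 0"
  obtains x s t where "x \<noteq> 0" "a = - (x ^ 4 * (s * t * (1 + s + t)))"
proof -
  obtain x y z w where *: "a = x * (y * (z * w))" "x + (y + (z + w)) = 0"
    using assms unfolding balanced_def by (auto simp: eval_nat_numeral length_Suc_conv)
  then have "w + (x + y + z) = 0" by (simp only: ac_simps)
  then have w: "w = - (x + y + z)" by (simp only: eq_neg_iff_add_eq_0)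
  have "x \<noteq> 0" using * assms by auto
  moreover from this have "a = - (x ^ 4 * (y / x * (z / x) * (1 + y / x + z / x)))"
    unfolding * w by (simp add: field_simps eval_nat_numeral)
  ultimately show ?thesis using that[of x "y / x" "z / x"] by blast
qed

text \<open>
  All nonzero cubes are 1, and \<open>t * (1 + t) = 1\<close> for each \<open>t\<close> other than 0 and 1, so 1 is
  the only nonzero balanced element.
\<close>
lemma card_4_not_balanced_3:
  assumes card: "CARD('a :: {field, finite}) = 4"
  shows "\<exists>a :: 'a. \<not> balanced 3 a"
proof -
  have two: "(2 :: 'a) = 0"
    unfolding card_eq_power_of_2_iff[symmetric] using card by (intro exI[of _ 2]) simp
  have cube: "x ^ 3 = 1" if "x \<noteq> 0" for x :: 'a
    using power_card_minus_1[OF that] card by simp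
  have "a = 1" if bal: "balanced 3 a" "a \<noteq> 0" for a :: 'a
  proof -
    obtain x t where *: "x \<noteq> 0" "t \<noteq> 0" "t \<noteq> - 1" "a = - (x ^ 3 * (t * (1 + t)))"
      using balanced_3_nonzeroE[OF bal] .
    have "t \<noteq> 1" using *(3) two by (metis add.inverse_unique one_add_one)
    moreover have "(t - 1) * (1 + t + t ^ 2) = t ^ 3 - 1"
      by (simp add: algebra_simps power2_eq_square power3_eq_cube)
    ultimately have "1 + t + t ^ 2 = 0" using cube[OF *(2)] by simp
    then have "t * (1 + t) = - 1" by (simp add: algebra_simps power2_eq_square eq_neg_iff_add_eq_0)
    then show "a = 1" using * cube[OF *(1)] by simp
  qed
  moreover have "\<exists>a :: 'a. a \<noteq> 0 \<and> a \<noteq> 1"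
    using card by (intro exists_avoiding_two) simp
  ultimately show ?thesis by blast
qed

text \<open>
  Nonzero cubes have square 1, so the square of a balanced nonzero element is
  \<open>(t * (1 + t)) ^ 2\<close> for some \<open>t\<close>; but \<open>3 ^ 2 = 2\<close> is not of this form.
\<close>
lemma card_7_not_balanced_3:
  assumes card: "CARD('a :: {field, finite}) = 7"
  shows "\<not> balanced 3 (3 :: 'a)"
proof
  assume bal: "balanced 3 (3 :: 'a)"
  have eq: "of_nat m = (of_nat n :: 'a) \<longleftrightarrow> m mod 7 = n mod 7" for m n
    using prime_field_elements(1)[where 'a = 'a] card prime_2_3_5_7
    by (simp add: of_nat_eq_iff_cong_CHAR cong_def)
  have "(3 :: 'a) \<noteq> 0" using eq[of 3 0] by simp
  then obtain x t where *: "x \<noteq> 0" "(3 :: 'a) = - (x ^ 3 * (t * (1 + t)))"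
    using balanced_3_nonzeroE[OF bal] by metis
  obtain m where m: "m < 7" "t = of_nat m"
    using prime_field_elements(2)[of t] card prime_2_3_5_7 by auto
  have "(3 :: 'a) ^ 2 = (x ^ 3) ^ 2 * (t * (1 + t)) ^ 2"
    using *(2) by (metis power2_minus power_mult_distrib)
  also have "(x ^ 3) ^ 2 = 1"
    using power_card_minus_1[OF *(1)] card by (simp flip: power_mult)
  finally have "of_nat (3 ^ 2) = (of_nat ((m * (1 + m)) ^ 2) :: 'a)"
    by (simp only: m(2) of_nat_mult of_nat_add of_nat_power of_nat_1 of_nat_numeral mult_1)
  then have "3 ^ 2 mod 7 = (m * (1 + m)) ^ 2 mod 7" using eq by blast
  moreover have "\<forall>m\<in>set [0..<7]. 3 ^ 2 mod 7 \<noteq> (m * (1 + m)) ^ 2 mod (7 :: nat)" by code_simp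
  ultimately show False using m by auto
qed

text \<open>
  All nonzero fourth powers are 1, so a nonzero balanced element is
  \<open>- (s * t * (1 + s + t))\<close> for some \<open>s\<close> and \<open>t\<close>.
\<close>
lemma card_3_5_not_balanced_4:
  assumes card: "CARD('a :: {field, finite}) \<in> {3, 5}"
  shows "\<not> balanced 4 (if CARD('a) = 3 then - 1 else - 2 :: 'a)"
proof
  let ?a = "if CARD('a) = 3 then 1 else 2"
  assume "balanced 4 (if CARD('a) = 3 then - 1 else - 2 :: 'a)"
  then have bal: "balanced 4 (- of_nat ?a :: 'a)" by (simp split: if_splits)
  have prime: "prime CARD('a)" using card prime_2_3_5_7 by auto
  have eq: "of_nat m = (of_nat n :: 'a) \<longleftrightarrow> m mod CARD('a) = n mod CARD('a)" for m n
    using prime_field_elements(1)[OF prime] by (simp add: of_nat_eq_iff_cong_CHAR cong_def)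
  have "of_nat ?a \<noteq> (of_nat 0 :: 'a)" unfolding eq using card by auto
  then have "- of_nat ?a \<noteq> (0 :: 'a)" by simp
  then obtain x s t where *: "x \<noteq> 0" "- of_nat ?a = - (x ^ 4 * (s * t * (1 + s + t)) :: 'a)"
    using balanced_4_nonzeroE[OF bal] by metis
  have "x ^ 4 = 1"
  proof (cases "CARD('a) = 3")
    case True
    then have "x ^ 2 = 1" using power_card_minus_1[OF *(1)] by simp
    then have "(x ^ 2) ^ 2 = 1" by (simp only: power_one)
    then show ?thesis by simp
  next
    case False
    then show ?thesis using power_card_minus_1[OF *(1)] card by simp
  qed
  moreover obtain m n where mn: "m < CARD('a)" "s = of_nat m" "n < CARD('a)" "t = of_nat n"
    using prime_field_elements(2)[OF prime, of s] prime_field_elements(2)[OF prime, of t] by auto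
  ultimately have "of_nat ?a = (of_nat (m * n * (1 + m + n)) :: 'a)"
    using *(2) by (simp only: neg_equal_iff_equal of_nat_mult of_nat_add of_nat_1 mult_1)
  then have "?a mod CARD('a) = m * n * (1 + m + n) mod CARD('a)" using eq by blast
  moreover have "\<forall>m\<in>set [0..<3]. \<forall>n\<in>set [0..<3]. 1 mod 3 \<noteq> m * n * (1 + m + n) mod (3 :: nat)"
    "\<forall>m\<in>set [0..<5]. \<forall>n\<in>set [0..<5]. 2 mod 5 \<noteq> m * n * (1 + m + n) mod (5 :: nat)" by code_simp+
  ultimately show False using mn card by auto
qed

lemma card_4_balanced_5:
  assumes card: "CARD('a :: {field, finite}) = 4"
  shows "balanced 5 (a :: 'a)"
proof -
  have two: "(2 :: 'a) = 0"
    unfolding card_eq_power_of_2_iff[symmetric] using card by (intro exI[of _ 2]) simp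
  obtain w :: 'a where w: "w \<noteq> 0" "w \<noteq> -1"
    using exists_avoiding_two[of 0 "- 1 :: 'a"] card by auto
  have "1 + (1 + (1 + (w + - (1 + w)))) = (2 :: 'a)" by (simp add: algebra_simps)
  then have "balanced 5 (- (w * (1 + w)))"
    using two by (intro balancedI[of "[1, 1, 1, w, - (1 + w)]"]) (auto simp: algebra_simps)
  moreover have "- (w * (1 + w)) \<noteq> 0" using w by (auto simp: add_eq_0_iff)
  ultimately show ?thesis
    by (rule balanced_if_exponent_invertible[where m = 2 and d = 3]) (use card in auto)
qed

lemma card_7_balanced_5:
  assumes card: "CARD('a :: {field, finite}) = 7"
  shows "balanced 5 (a :: 'a)"
proof -
  have seven: "(7 :: 'a) = 0" using of_nat_card_eq_0[where 'a = 'a] card by simp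
  have "CHAR('a) = 7" using prime_field_elements(1)[where 'a = 'a] card prime_2_3_5_7 by simp
  then have "(of_nat 3 :: 'a) \<noteq> 0" unfolding of_nat_eq_0_iff_char_dvd by simp
  then have nz: "(3 :: 'a) \<noteq> 0" by simp
  have "balanced 5 (3 :: 'a)"
    by (rule balancedI[of "[1, 1, 1, 1, 3]"]) (use seven in auto)
  then show ?thesis
    using nz by (rule balanced_if_exponent_invertible[where m = 5 and d = 4]) (use card in auto)
qed

lemma card_3_balanced_6:
  assumes card: "CARD('a :: {field, finite}) = 3"
  shows "balanced 6 (a :: 'a)"
proof -
  have three: "(3 :: 'a) = 0" using of_nat_card_eq_0[where 'a = 'a] card by simp
  have "(6 :: 'a) = 2 * 3" by simp
  then have "(6 :: 'a) = 0" by (simp only: three mult_zero_right)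
  then have "balanced 6 (1 :: 'a)"
    by (intro balancedI[of "[1, 1, 1, 1, 1, 1]"]) auto
  moreover have "balanced 6 (- 1 :: 'a)"
    by (rule balancedI[of "[1, - 1, 1, - 1, 1, - 1]"]) auto
  moreover have "a = 0 \<or> a ^ 2 = 1" using power_card_minus_1[of a] card by auto
  then have "a = 0 \<or> a = 1 \<or> a = - 1" by (auto simp: power2_eq_1_iff)
  ultimately show ?thesis using balanced_0[of 6] by auto
qed

text \<open>
  The nonzero sixth powers are \<open>1\<close> and \<open>-1 = 2 ^ 6\<close>, so one decomposition of a square and
  one of a nonsquare suffice.
\<close>
lemma card_5_balanced_6:
  assumes card: "CARD('a :: {field, finite}) = 5"
  shows "balanced 6 (a :: 'a)"
proof -
  have five: "(5 :: 'a) = 0" using of_nat_card_eq_0[where 'a = 'a] card by simp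
  have neg1: "(2 :: 'a) ^ 6 = - 1"
  proof -
    have "(2 :: 'a) ^ 6 = 5 * 13 - 1" by simp
    then show ?thesis by (simp add: five)
  qed
  have neg4: "(- 1 :: 'a) = 4"
    using five by (simp add: minus_equation_iff eq_neg_iff_add_eq_0)
  have "balanced 6 (- 1 :: 'a)"
    by (rule balancedI[of "[1, - 1, 1, - 1, 1, - 1]"]) auto
  moreover from balanced_scale[OF this, of 2] have "balanced 6 (1 :: 'a)"
    unfolding neg1 by simp
  moreover have "balanced 6 (- 2 :: 'a)"
    by (rule balancedI[of "[1, 1, 1, 1, 2, - 1]"]) (use five in auto)
  moreover from balanced_scale[OF this, of 2] have "balanced 6 (2 :: 'a)"
    unfolding neg1 by simp
  moreover have "a = 0 \<or> a = 1 \<or> a = - 1 \<or> a = 2 \<or> a = - 2"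
  proof -
    have "a * (a - 1) * (a + 1) * (a - 2) * (a + 2) = a * (a ^ 4 - 5 * a ^ 2 + 4)"
      by (simp add: algebra_simps eval_nat_numeral)
    also have "\<dots> = 0"
      using power_card_minus_1[of a] card neg4 by (cases "a = 0") (auto simp: five simp flip: neg4)
    finally show ?thesis by (auto simp: right_minus_eq add_eq_0_iff2)
  qed
  ultimately show ?thesis using balanced_0[of 6] by auto
qed

theorem theorem2:
  fixes k :: nat
  assumes "k \<ge> 2"
  shows "(\<forall>a :: 'a :: {field, finite}. \<exists>x :: nat \<Rightarrow> 'a.
            a = (\<Prod>i = 1..k. x i) \<and> (\<Sum>i = 1..k. x i) = 0)
    \<longleftrightarrow>
      (CARD('a) = 2 \<and> even k)
    \<or> (CARD('a) = 4 \<and> k \<noteq> 3)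
    \<or> ((\<exists>n :: nat. CARD('a) = 2 ^ n) \<and> CARD('a) \<noteq> 2 \<and> CARD('a) \<noteq> 4)
    \<or> (CARD('a) \<in> {3, 5} \<and> k \<notin> {2, 4})
    \<or> (CARD('a) = 7 \<and> k \<notin> {2, 3})
    \<or> ((\<nexists>n :: nat. CARD('a) = 2 ^ n) \<and> CARD('a) \<notin> {3, 5, 7} \<and> k \<noteq> 2)"
    (is "?lhs \<longleftrightarrow> ?rhs")
proof -
  define B where "B k \<longleftrightarrow> (\<forall>a :: 'a. balanced k a)" for k
  have lhs: "?lhs \<longleftrightarrow> B k"
    unfolding B_def balanced_iff_indexed ..
  have step: "B l" if "B j" "j \<le> l" "even (l - j)" for j l
    using that balanced_add_even[of j l] unfolding B_def by blast
  note pow2 = card_eq_power_of_2_iff[where 'a = 'a]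
  have B2: "B 2 \<longleftrightarrow> (2 :: 'a) = 0"
    unfolding B_def by (rule all_balanced_2_iff)
  have B3: "B 3" if "CARD('a) \<notin> {2, 4, 7}"
    using balanced_3[OF that] by (simp add: B_def)
  have B4: "B 4" if "(2 :: 'a) \<noteq> 0" "CARD('a) \<notin> {3, 5}"
    using balanced_4[OF that] by (simp add: B_def)
  have two_zero: "(2 :: 'a) = 0" if "CARD('a) \<in> {2, 4}"
    using that pow2 by (metis insertE singletonD power_one_right power2_eq_square mult_2 numeral_Bit0)
  have two_nonzero: "(2 :: 'a) \<noteq> 0" if "CARD('a) \<in> {3, 5, 7}"
  proof
    assume "(2 :: 'a) = 0"
    then obtain n where "CARD('a) = 2 ^ n" using pow2 by blast
    moreover have "n \<noteq> 0" using that calculation by (cases n) auto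
    ultimately have "even CARD('a)" by simp
    then show False using that by auto
  qed
  show ?thesis
  proof (cases "(2 :: 'a) = 0")
    case True
    consider "CARD('a) = 2" | "CARD('a) = 4" | "CARD('a) \<notin> {2, 4}" by blast
    then show ?thesis
    proof cases
      case 1
      have "B k \<longleftrightarrow> even k" using card_2_balanced_iff[OF 1] assms by (auto simp: B_def)
      then show ?thesis unfolding lhs using 1 pow2 True by auto
    next
      case 2
      have "\<not> B 3" using card_4_not_balanced_3[OF 2] by (simp add: B_def)
      moreover have "B k" if "even k"
        using step[of 2 k] B2 True assms that by simp
      moreover have "B k" if "odd k" "k \<noteq> 3"
      proof (rule step[of 5])
        show "B 5" using card_4_balanced_5[OF 2] by (simp add: B_def)
        show "5 \<le> k" using assms that by presburger
        then show "even (k - 5)" using that by simp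
      qed
      ultimately have "B k \<longleftrightarrow> k \<noteq> 3" by auto
      then show ?thesis unfolding lhs using 2 pow2 True by auto
    next
      case 3
      have "B k"
      proof (cases "even k")
        case True
        then show ?thesis using step[of 2 k] B2 \<open>(2 :: 'a) = 0\<close> assms by simp
      next
        case False
        then have "k \<ge> 3" using assms by presburger
        moreover have "CARD('a) \<noteq> 7" using two_nonzero True by auto
        ultimately show ?thesis using step[of 3 k] B3 3 False by simp
      qed
      then show ?thesis unfolding lhs using 3 pow2 True by auto
    qed
  next
    case False
    have k2: "\<not> B 2" using B2 False by simp
    have card24: "CARD('a) \<notin> {2, 4}" using two_zero False by blast
    have odd_ge: "k \<ge> 3" if "odd k" using assms that by presburger
    have even_ge: "k \<ge> 4" if "even k" "k \<noteq> 2" using assms that by presburger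
    consider "CARD('a) \<in> {3, 5}" | "CARD('a) = 7" | "CARD('a) \<notin> {3, 5, 7}" by blast
    then show ?thesis
    proof cases
      case 1
      have "\<not> B 4" using card_3_5_not_balanced_4[OF 1] unfolding B_def by blast
      moreover have "B k" if "odd k"
        using step[of 3 k] B3 1 that odd_ge by auto
      moreover have "B k" if "even k" "k \<noteq> 2" "k \<noteq> 4"
      proof (rule step[of 6])
        show "B 6" using 1 card_3_balanced_6 card_5_balanced_6 by (auto simp: B_def)
        show "6 \<le> k" using assms that by presburger
        then show "even (k - 6)" using that by simp
      qed
      ultimately have "B k \<longleftrightarrow> k \<notin> {2, 4}" using k2 by auto
      then show ?thesis unfolding lhs using 1 pow2 False by auto
    next
      case 2
      have "\<not> B 3" using card_7_not_balanced_3[OF 2] unfolding B_def by blast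
      moreover have "B k" if "even k" "k \<noteq> 2"
        using step[of 4 k] B4 2 False that even_ge by auto
      moreover have "B k" if "odd k" "k \<noteq> 3"
      proof (rule step[of 5])
        show "B 5" using card_7_balanced_5[OF 2] by (simp add: B_def)
        show "5 \<le> k" using assms that by presburger
        then show "even (k - 5)" using that by simp
      qed
      ultimately have "B k \<longleftrightarrow> k \<notin> {2, 3}" using k2 by auto
      then show ?thesis unfolding lhs using 2 pow2 False by auto
    next
      case 3
      have "B k" if "k \<noteq> 2"
        using step[of 3 k] step[of 4 k] B3 B4 3 False card24 that odd_ge even_ge by (cases "even k") auto
      then have "B k \<longleftrightarrow> k \<noteq> 2" using k2 by auto
      then show ?thesis unfolding lhs using 3 card24 pow2 False by auto
    qed
  qed
qed

end
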